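(* If $G$ is a bipartite graph, then $m_c(G) = 2$.
   Context: Graphs are finite and simple. For positive integers $p,q$ with $p/q\ge 2$, a $(p,q)$-colouring of $G$ is a map $f: V(G) \to \{0,1,\dots,p-1\}$ such that $q \leq |f(u)-f(v)| \leq p-q$ for every edge $uv$. $G$ is $(p,q)$-mixing (also written $G_{p,q}$-mixing) if any two $(p,q)$-colourings of $G$ are joined by a finite sequence of $(p,q)$-colourings of $G$ in which consecutive colourings differ on at most one vertex. The circular mixing number of $G$ is $m_c(G) = \inf\{\frac{p}{q} : p,q \text{ positive integers},\ \frac{p}{q} \ge 2,\ G \text{ is } (p,q)\text{-mixing}\}$. *)

theory Defs
  imports Complex_Main "HOL-Library.FuncSet" "Graph_Theory.Digraph"
begin

text \<open>
  A finite simple graph is an instance of the locale \<^locale>\<open>graph\<close>: a finite, symmetric,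
  loop-free digraph without parallel arcs, each undirected edge being a pair of opposite arcs.
\<close>

definition bipartite :: "('a, 'b) pre_digraph \<Rightarrow> bool" where
  "bipartite G \<longleftrightarrow> (\<exists>A B. verts G = A \<union> B \<and> A \<inter> B = {} \<and>
     (\<forall>u v. u \<rightarrow>\<^bsub>G\<^esub> v \<longrightarrow> (u \<in> A \<and> v \<in> B) \<or> (u \<in> B \<and> v \<in> A)))"

text \<open>
  Colourings are extensional (\<open>undefined\<close> outside the vertex set), so that two colourings are
  equal iff they agree on all vertices. Differences are taken in the integers, as subtraction of
  natural numbers truncates.
\<close>

definition pq_colourings :: "('a, 'b) pre_digraph \<Rightarrow> nat \<Rightarrow> nat \<Rightarrow> ('a \<Rightarrow> nat) set" where
  "pq_colourings G p q = {f \<in> verts G \<rightarrow>\<^sub>E {0..<p}.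
     \<forall>u v. u \<rightarrow>\<^bsub>G\<^esub> v \<longrightarrow>
       int q \<le> \<bar>int (f u) - int (f v)\<bar> \<and> \<bar>int (f u) - int (f v)\<bar> \<le> int p - int q}"

definition recolouring_step ::
    "('a, 'b) pre_digraph \<Rightarrow> nat \<Rightarrow> nat \<Rightarrow> ('a \<Rightarrow> nat) \<Rightarrow> ('a \<Rightarrow> nat) \<Rightarrow> bool" where
  "recolouring_step G p q f g \<longleftrightarrow> f \<in> pq_colourings G p q \<and> g \<in> pq_colourings G p q \<and>
     card {v \<in> verts G. f v \<noteq> g v} \<le> 1"

definition pq_mixing :: "('a, 'b) pre_digraph \<Rightarrow> nat \<Rightarrow> nat \<Rightarrow> bool" where
  "pq_mixing G p q \<longleftrightarrow>
     (\<forall>f\<in>pq_colourings G p q. \<forall>g\<in>pq_colourings G p q. (recolouring_step G p q)\<^sup>*\<^sup>* f g)"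

text \<open>
  The set is bounded below by 2; the infimum is the intended one provided the set is nonempty
  (\<^term>\<open>Inf {} :: real\<close> is an unspecified value).
\<close>

definition circular_mixing_number :: "('a, 'b) pre_digraph \<Rightarrow> real" where
  "circular_mixing_number G =
     Inf {real p / real q | p q. p > 0 \<and> q > 0 \<and> real p / real q \<ge> 2 \<and> pq_mixing G p q}"

end

theory Submission
  imports Defs "HOL-Number_Theory.Cong"
begin

text \<open>
  Take \<open>p = 2 q + 1\<close> with \<open>q\<close> at least the number of vertices. Subtracting \<open>q\<close> modulo \<open>p\<close> from the
  colours on one side \<open>B\<close> turns a colouring into a map to the cycle of length \<open>p\<close> that increases by
  0 or 1 along each edge towards \<open>B\<close>. Some residue is missed, so the cycle can be cut there and the
  map lifts to an integer height function. Raising a height function to \<open>max h c\<close> for growing \<open>c\<close>,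
  side \<open>B\<close> first, changes one vertex at a time and ends in a constant function. Hence all
  colourings are connected, and \<open>p / q = 2 + 1 / q\<close> tends to 2.
\<close>

section \<open>Reversibility of recolouring and arithmetic of residues\<close>

lemma recolouring_step_sym:
  "recolouring_step G p q f g \<Longrightarrow> recolouring_step G p q g f"
  unfolding recolouring_step_def by (simp add: eq_commute)

lemma recolouring_rtranclp_sym:
  "(recolouring_step G p q)\<^sup>*\<^sup>* f g \<Longrightarrow> (recolouring_step G p q)\<^sup>*\<^sup>* g f"
  by (metis recolouring_step_sym symp_def symp_rtranclp)

text \<open>With \<open>d = y - x\<close>, the shifted residue is \<open>a + q + d\<close>, less
  \<open>p\<close> on wrapping. The distance to \<open>a\<close> is then \<open>q + d\<close> or
  \<open>q + 1 - d\<close>.\<close>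

lemma mod_odd_shift_diff:
  fixes x y q :: int
  assumes "q \<ge> 0" "y - x \<in> {0, 1}"
  shows "\<bar>(y + q) mod (2 * q + 1) - x mod (2 * q + 1)\<bar> \<in> {q, q + 1}"
proof -
  define p where "p = 2 * q + 1"
  define a where "a = x mod p"
  define d where "d = y - x"
  have "p > 0" using assms(1) by (simp add: p_def)
  then have a: "0 \<le> a" "a < p" by (simp_all add: a_def)
  have d: "d = 0 \<or> d = 1" using assms(2) by (auto simp: d_def)
  have "(y + q) mod p = (x + (q + d)) mod p" by (simp add: d_def algebra_simps)
  also have "\<dots> = (a + (q + d)) mod p" by (simp add: a_def mod_add_left_eq)
  also have "\<dots> = (if a + (q + d) < p then a + (q + d) else a + (q + d) - p)"
  proof (cases "a + (q + d) < p")
    case False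
    have "(a + (q + d)) mod p = (a + (q + d) - p) mod p" by simp
    also have "\<dots> = a + (q + d) - p"
      by (rule mod_pos_pos_trivial) (use False a d assms(1) in \<open>auto simp: p_def\<close>)
    finally show ?thesis using False by simp
  qed (use a d assms(1) in \<open>auto intro!: mod_pos_pos_trivial\<close>)
  finally have "(y + q) mod p = (if a + (q + d) < p then a + (q + d) else a + (q + d) - p)" .
  then show ?thesis unfolding p_def[symmetric] a_def[symmetric]
    using d assms(1) by (auto simp: p_def)
qed

text \<open>The number \<open>b - a - d\<close> is a multiple of \<open>p\<close> strictly between
  \<open>- p\<close> and \<open>p\<close>. With residue \<open>p - 1\<close> allowed,
  \<open>a = p - 1\<close>, \<open>b = 0\<close>, \<open>d = 1\<close> would give
  \<open>- p\<close>; this is why the cycle has to be cut at a missed residue.\<close>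

lemma diff_eq_if_mod_eq:
  fixes a b d p :: int
  assumes "[b - a = d] (mod p)" "d \<in> {0, 1}" "a \<in> {0..p - 2}" "b \<in> {0..p - 2}"
  shows "b - a = d"
proof -
  obtain k where k: "b - a - d = p * k" using assms(1) by (auto simp: cong_iff_dvd_diff)
  have "- p < p * k" "p * k < p" unfolding k[symmetric] using assms(2-4) by auto
  then have "p * (- 1) < p * k" "p * k < p * 1" by simp_all
  moreover have "p > 0" using assms(3) by simp
  ultimately have "- 1 < k" "k < 1" by (simp_all only: mult_less_cancel_left_pos)
  then have "k = 0" by simp
  then show ?thesis using k by simp
qed

section \<open>Integer heights and colourings modulo \<open>2 * q + 1\<close>\<close>

locale bipartitioned_digraph = fin_digraph G for G :: "('a, 'b) pre_digraph" +
  fixes B :: "'a set" and q :: nat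
  assumes cross: "u \<rightarrow>\<^bsub>G\<^esub> v \<Longrightarrow> u \<in> B \<longleftrightarrow> v \<notin> B"
begin

text \<open>Both arc directions are listed because \<open>fin_digraph\<close> does not provide
  symmetry.\<close>

definition height_fun :: "('a \<Rightarrow> int) \<Rightarrow> bool" where
  "height_fun h \<longleftrightarrow>
     (\<forall>u v. (u \<rightarrow>\<^bsub>G\<^esub> v \<or> v \<rightarrow>\<^bsub>G\<^esub> u) \<and> u \<notin> B \<and> v \<in> B \<longrightarrow> h v - h u \<in> {0, 1})"

definition offset :: "'a \<Rightarrow> int" where
  "offset v = (if v \<in> B then int q else 0)"

definition colouring_of :: "('a \<Rightarrow> int) \<Rightarrow> 'a \<Rightarrow> nat" where
  "colouring_of h = (\<lambda>v\<in>verts G. nat ((h v + offset v) mod (2 * int q + 1)))"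

abbreviation "recolourable \<equiv> (recolouring_step G (2 * q + 1) q)\<^sup>*\<^sup>*"

text \<open>For \<open>p = 2 * q + 1\<close> the permitted distances are just \<open>q\<close> and
  \<open>q + 1\<close>, the two values given by \<open>mod_odd_shift_diff\<close>.\<close>

lemma colouring_of_mem:
  assumes "height_fun h"
  shows "colouring_of h \<in> pq_colourings G (2 * q + 1) q"
proof -
  have range: "colouring_of h \<in> verts G \<rightarrow>\<^sub>E {0..<2 * q + 1}"
  proof (rule PiE_I)
    fix v assume "v \<in> verts G"
    have "(h v + offset v) mod (2 * int q + 1) < 2 * int q + 1" by (rule pos_mod_bound) simp
    then show "colouring_of h v \<in> {0..<2 * q + 1}"
      using \<open>v \<in> verts G\<close> by (simp add: colouring_of_def nat_less_iff)
  qed (simp add: colouring_of_def)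
  have diff: "\<bar>int (colouring_of h v) - int (colouring_of h u)\<bar> \<in> {int q, int q + 1}"
    if "u \<rightarrow>\<^bsub>G\<^esub> v \<or> v \<rightarrow>\<^bsub>G\<^esub> u" "u \<notin> B" "v \<in> B" for u v
  proof -
    have "u \<in> verts G" "v \<in> verts G" using that(1) adj_in_verts by auto
    moreover have "h v - h u \<in> {0, 1}" using assms that unfolding height_fun_def by blast
    ultimately show ?thesis
      using mod_odd_shift_diff[of "int q" "h v" "h u"] that(2,3)
      by (simp add: colouring_of_def offset_def)
  qed
  have "int q \<le> \<bar>int (colouring_of h u) - int (colouring_of h v)\<bar> \<and>
      \<bar>int (colouring_of h u) - int (colouring_of h v)\<bar> \<le> int (2 * q + 1) - int q"
    if "u \<rightarrow>\<^bsub>G\<^esub> v" for u v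
    using diff[of u v] diff[of v u] cross[OF that] that by (cases "u \<in> B") auto
  then show ?thesis using range unfolding pq_colourings_def by blast
qed

text \<open>A side of the bipartition is independent, so its vertices can be switched from
  \<open>h\<close> to \<open>h'\<close> one at a time in any order.\<close>

lemma recolourable_if_eq_off_side:
  assumes h: "height_fun h" and h': "height_fun h'"
    and X: "X = B \<or> X = - B" and eq: "\<And>v. v \<notin> X \<Longrightarrow> h' v = h v"
  shows "recolourable (colouring_of h) (colouring_of h')"
proof -
  \<comment> \<open>An edge has only one end in \<open>X\<close>, so on each edge the mixture agrees with \<open>h\<close> or with \<open>h'\<close>.\<close>
  have mixture: "height_fun (override_on h h' D)" for D
    unfolding height_fun_def
  proof (intro allI impI)
    fix u v assume uv: "(u \<rightarrow>\<^bsub>G\<^esub> v \<or> v \<rightarrow>\<^bsub>G\<^esub> u) \<and> u \<notin> B \<and> v \<in> B"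
    then have "h v - h u \<in> {0, 1}" "h' v - h' u \<in> {0, 1}"
      using h h' unfolding height_fun_def by blast+
    moreover have "h' u = h u \<or> h' v = h v" using X eq uv by auto
    ultimately show "override_on h h' D v - override_on h h' D u \<in> {0, 1}"
      by (auto simp: override_on_def)
  qed
  \<comment> \<open>\<open>D\<close> collects the vertices already switched; switching one outside
    \<open>X\<close> changes nothing.\<close>
  have "recolourable (colouring_of h) (colouring_of (override_on h h' D))"
    if "finite D" for D
    using that
  proof induction
    case (insert x D)
    have "{v \<in> verts G. colouring_of (override_on h h' D) v
        \<noteq> colouring_of (override_on h h' (insert x D)) v} \<subseteq> {x}"
      by (auto simp: colouring_of_def override_on_def split: if_splits)
    then have "card {v \<in> verts G. colouring_of (override_on h h' D) v
        \<noteq> colouring_of (override_on h h' (insert x D)) v} \<le> card {x}"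
      by (rule card_mono[rotated]) simp
    then have "recolouring_step G (2 * q + 1) q (colouring_of (override_on h h' D))
        (colouring_of (override_on h h' (insert x D)))"
      unfolding recolouring_step_def using colouring_of_mem mixture by simp
    with insert.IH show ?case by (metis rtranclp.rtrancl_into_rtrancl)
  qed simp
  moreover have "colouring_of (override_on h h' (verts G)) = colouring_of h'"
    by (auto simp: colouring_of_def)
  ultimately show ?thesis using finite_verts by metis
qed

text \<open>Both thresholds are themselves height functions, and the pointwise maximum of two height
  functions is again one.\<close>

lemma height_fun_max:
  assumes "height_fun h"
  shows "height_fun (\<lambda>v. max (h v) c)"
    and "height_fun (\<lambda>v. max (h v) (if v \<in> B then c + 1 else c))"
proof -
  have "h v - h u = 0 \<or> h v - h u = 1"
    if "u \<rightarrow>\<^bsub>G\<^esub> v \<or> v \<rightarrow>\<^bsub>G\<^esub> u" "u \<notin> B" "v \<in> B" for u v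
    using assms that unfolding height_fun_def by blast
  then show "height_fun (\<lambda>v. max (h v) c)"
    and "height_fun (\<lambda>v. max (h v) (if v \<in> B then c + 1 else c))"
    unfolding height_fun_def by (smt (verit) insert_iff singleton_iff)+
qed

lemma recolourable_max:
  assumes "height_fun h"
  shows "recolourable (colouring_of (\<lambda>v. max (h v) c)) (colouring_of (\<lambda>v. max (h v) (c + int n)))"
proof (induction n)
  case (Suc n)
  let ?c = "c + int n"
  \<comment> \<open>\<open>B\<close> rises first: across an edge its height may exceed the other one
    by 1 but never fall below it.\<close>
  let ?mid = "\<lambda>v. max (h v) (if v \<in> B then ?c + 1 else ?c)"
  note Suc.IH
  also have "recolourable (colouring_of (\<lambda>v. max (h v) ?c)) (colouring_of ?mid)"
    by (rule recolourable_if_eq_off_side[where X = B]) (auto intro: height_fun_max assms)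
  also have "recolourable (colouring_of ?mid) (colouring_of (\<lambda>v. max (h v) (?c + 1)))"
    by (rule recolourable_if_eq_off_side[where X = "- B"]) (auto intro: height_fun_max assms)
  also have "?c + 1 = c + int (Suc n)" by simp
  finally show ?case .
qed simp

lemma recolourable_constant:
  assumes h: "height_fun h"
  shows "recolourable (colouring_of h) (colouring_of (\<lambda>v. 0))"
proof -
  \<comment> \<open>A sum serves as a bound that also makes sense when there are no
    vertices.\<close>
  define M where "M = (\<Sum>v\<in>verts G. \<bar>h v\<bar>)"
  define p where "p = 2 * int q + 1"
  have bound: "\<bar>h v\<bar> \<le> M" if "v \<in> verts G" for v
    unfolding M_def using that by (intro member_le_sum) auto
  have M: "0 \<le> M" unfolding M_def by (simp add: sum_nonneg)
  have "1 * M \<le> p * M" unfolding p_def by (intro mult_right_mono M) simp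
  then have pM: "M \<le> p * M" by simp
  \<comment> \<open>The threshold \<open>- M\<close> leaves \<open>h\<close> unchanged. After
    \<open>p * M + M\<close> rounds it is \<open>p * M\<close>, which dominates \<open>h\<close>
    and, as a multiple of \<open>p\<close>, gives the same colouring as height 0.\<close>
  have "recolourable (colouring_of (\<lambda>v. max (h v) (- M)))
      (colouring_of (\<lambda>v. max (h v) (- M + int (nat (p * M + M)))))"
    by (rule recolourable_max[OF h])
  moreover have "colouring_of (\<lambda>v. max (h v) (- M)) = colouring_of h"
    unfolding colouring_of_def
  proof (intro restrict_ext)
    fix v assume "v \<in> verts G"
    then have "max (h v) (- M) = h v" using bound[of v] by (simp add: abs_le_iff max_absorb1)
    then show "nat ((max (h v) (- M) + offset v) mod (2 * int q + 1))
        = nat ((h v + offset v) mod (2 * int q + 1))"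
      by simp
  qed
  moreover have "colouring_of (\<lambda>v. max (h v) (- M + int (nat (p * M + M)))) = colouring_of (\<lambda>v. 0)"
    unfolding colouring_of_def p_def[symmetric]
  proof (intro restrict_ext)
    fix v assume "v \<in> verts G"
    then have "max (h v) (- M + int (nat (p * M + M))) = p * M"
      using bound[of v] M pM by (simp add: max_def)
    then show "nat ((max (h v) (- M + int (nat (p * M + M))) + offset v) mod p)
        = nat ((0 + offset v) mod p)"
      by simp
  qed
  ultimately show ?thesis by simp
qed

lemma exists_height_fun:
  assumes f: "f \<in> pq_colourings G (2 * q + 1) q" and card: "card (verts G) \<le> q"
  obtains h where "height_fun h" "colouring_of h = f"
proof -
  define p where "p = 2 * int q + 1"
  have p: "p > 0" by (simp add: p_def)
  define g where "g v = (int (f v) - offset v) mod p" for v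
  \<comment> \<open>At most \<open>q\<close> of the \<open>2 * q + 1\<close> residues occur, so some
    \<open>r\<close> is missed.\<close>
  have "card (g ` verts G) < card {0..<p}"
    using card_image_le[of "verts G" g] card by (simp add: p_def)
  then obtain r where r: "r \<in> {0..<p}" "r \<notin> g ` verts G"
    by (metis card_mono finite_imageI finite_verts leD subsetI)
  \<comment> \<open>Counting residues from \<open>r + 1\<close> moves the missed one to
    \<open>p - 1\<close>.\<close>
  define h where "h v = (int (f v) - offset v - (r + 1)) mod p" for v
  have h_range: "h v \<in> {0..p - 2}" if "v \<in> verts G" for v
  proof -
    have "h v \<noteq> p - 1"
    proof
      assume "h v = p - 1"
      then have "(h v + (r + 1)) mod p = (r + p) mod p" by (simp add: ac_simps)
      moreover have "(h v + (r + 1)) mod p = g v" by (simp add: h_def g_def mod_simps)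
      ultimately show False using r that by force
    qed
    moreover have "0 \<le> h v" "h v < p" using p by (auto simp: h_def)
    ultimately show ?thesis by simp
  qed
  \<comment> \<open>Adding \<open>r + 1\<close> undoes the rotation, so that the induced colouring
    is \<open>f\<close> itself.\<close>
  have "height_fun (\<lambda>v. h v + (r + 1))"
    unfolding height_fun_def
  proof (intro allI impI)
    fix u v assume uv: "(u \<rightarrow>\<^bsub>G\<^esub> v \<or> v \<rightarrow>\<^bsub>G\<^esub> u) \<and> u \<notin> B \<and> v \<in> B"
    then have verts: "u \<in> verts G" "v \<in> verts G" using adj_in_verts by auto
    have "\<bar>int (f u) - int (f v)\<bar> \<in> {int q, int q + 1}"
      using f uv unfolding pq_colourings_def by force
    \<comment> \<open>The difference of colours is one of \<open>q\<close>, \<open>q + 1\<close>,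
      \<open>- q\<close>, \<open>- q - 1\<close>; subtracting \<open>q\<close> leaves 0 or 1 modulo
      \<open>p\<close>.\<close>
    then have "int (f v) - int (f u) - int q \<in> {0, 1, - p, 1 - p}"
      by (auto simp: p_def abs_if split: if_splits)
    then have "\<exists>d\<in>{0, 1}. [int (f v) - int (f u) - int q = d] (mod p)"
      by (auto simp: cong_iff_dvd_diff)
    then obtain d where d: "d \<in> {0, 1}" "[int (f v) - int (f u) - int q = d] (mod p)"
      by blast
    have "[h v - h u = (int (f v) - offset v - (r + 1)) - (int (f u) - offset u - (r + 1))] (mod p)"
      unfolding h_def by (intro cong_diff) simp_all
    also have "(int (f v) - offset v - (r + 1)) - (int (f u) - offset u - (r + 1))
        = int (f v) - int (f u) - int q"
      using uv by (simp add: offset_def)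
    also note d(2)
    finally have "h v - h u = d"
      using d(1) h_range verts by (intro diff_eq_if_mod_eq)
    then show "h v + (r + 1) - (h u + (r + 1)) \<in> {0, 1}" using d(1) by simp
  qed
  moreover have "colouring_of (\<lambda>v. h v + (r + 1)) = f"
  proof
    fix v
    have "f \<in> verts G \<rightarrow>\<^sub>E {0..<2 * q + 1}" using f by (simp add: pq_colourings_def)
    then have "v \<notin> verts G \<Longrightarrow> f v = undefined" "v \<in> verts G \<Longrightarrow> f v < 2 * q + 1"
      using PiE_arb[of f _ _ v] PiE_mem[of f _ _ v] by force+
    then have "v \<notin> verts G \<Longrightarrow> f v = undefined" "v \<in> verts G \<Longrightarrow> int (f v) mod p = int (f v)"
      by (simp_all add: p_def)
    moreover have "(h v + (r + 1) + offset v) mod p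
        = (int (f v) - offset v - (r + 1) + (r + 1 + offset v)) mod p"
      unfolding h_def add.assoc by (rule mod_add_left_eq)
    then have "(h v + (r + 1) + offset v) mod p = int (f v) mod p" by simp
    ultimately show "colouring_of (\<lambda>v. h v + (r + 1)) v = f v"
      by (simp add: colouring_of_def p_def[symmetric])
  qed
  ultimately show ?thesis by (rule that)
qed

section \<open>Mixing at \<open>2 + 1 / q\<close> and the infimum\<close>

lemma pq_mixing_odd:
  assumes "card (verts G) \<le> q"
  shows "pq_mixing G (2 * q + 1) q"
proof -
  have "recolourable f (colouring_of (\<lambda>v. 0))" if "f \<in> pq_colourings G (2 * q + 1) q" for f
    using exists_height_fun[OF that assms] recolourable_constant by metis
  then show ?thesis
    \<comment> \<open>Two colourings are joined through the one of height 0, with the second path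
      reversed.\<close>
    unfolding pq_mixing_def by (meson recolouring_rtranclp_sym rtranclp_trans)
qed

end

theorem corollary4p13:
  fixes G :: "('a, 'b) pre_digraph"
  assumes "graph G" and "bipartite G"
  shows "circular_mixing_number G = 2"
proof -
  define S where
    "S = {real p / real q | p q. p > 0 \<and> q > 0 \<and> real p / real q \<ge> 2 \<and> pq_mixing G p q}"
  interpret graph G by fact
  obtain A B where AB: "A \<inter> B = {}"
    "\<And>u v. u \<rightarrow>\<^bsub>G\<^esub> v \<Longrightarrow> (u \<in> A \<and> v \<in> B) \<or> (u \<in> B \<and> v \<in> A)"
    using assms(2) unfolding bipartite_def by blast
  have mem: "2 + 1 / real q \<in> S" if "q > 0" "card (verts G) \<le> q" for q
  proof -
    interpret bipartitioned_digraph G B q by unfold_locales (use AB in blast)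
    have "2 + 1 / real q = real (2 * q + 1) / real q" using that(1) by (simp add: field_simps)
    then show ?thesis
      unfolding S_def using that pq_mixing_odd
      by (intro CollectI exI[of _ "2 * q + 1"] exI[of _ q]) (auto simp: field_simps)
  qed
  have lower: "2 \<le> x" if "x \<in> S" for x using that by (auto simp: S_def)
  have "Inf S = 2"
  proof (rule antisym)
    \<comment> \<open>This instance of \<open>mem\<close> shows that \<open>S\<close> is nonempty,
      so \<open>Inf S\<close> is a genuine infimum.\<close>
    show "2 \<le> Inf S" using mem[of "Suc (card (verts G))"] lower by (intro cInf_greatest) auto
    show "Inf S \<le> 2"
    proof (rule field_le_epsilon)
      fix e :: real assume "e > 0"
      obtain n where n: "inverse (real (Suc n)) < e" using reals_Archimedean[OF \<open>e > 0\<close>] by blast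
      \<comment> \<open>Large enough both for mixing and for \<open>1 / q\<close> to be below
        \<open>e\<close>.\<close>
      define q where "q = Suc (n + card (verts G))"
      have "Inf S \<le> 2 + 1 / real q"
        using mem[of q] lower by (intro cInf_lower bdd_belowI) (auto simp: q_def)
      also have "1 / real q \<le> inverse (real (Suc n))"
        by (auto simp: q_def field_simps)
      finally show "Inf S \<le> 2 + e" using n by simp
    qed
  qed
  then show ?thesis by (simp add: circular_mixing_number_def S_def)
qed

end
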